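(* There exists a bounded metric space $(X,d)$ such that: (1) $X$ is completely metrizable (i.e. the topology induced by $d$ on $X$ is also induced by some complete metric on $X$); (2) $(CL(X),H_d)$ contains a closed copy of the rationals (i.e. a closed subspace homeomorphic to $\mathbb{Q}$ with its usual topology); in particular, $(CL(X),H_d)$ is not completely metrizable; (3) $(CL(X),H_d)$ is $\alpha$-favorable in the Banach-Mazur game, i.e. player $\alpha$ has a winning strategy in the Banach-Mazur game on $(CL(X),H_d)$; in particular, $(CL(X),H_d)$ is a Baire space.
   Context: For a metric space $(X,d)$, $CL(X)$ denotes the set of nonempty closed subsets of $X$. For $x\in X$ and $A\in CL(X)$, $d(x,A)=\inf\{d(x,a):a\in A\}$. The Hausdorff distance is $H_d(A_0,A_1)=\sup\{|d(x,A_0)-d(x,A_1)|:x\in X\}$ for $A_0,A_1\in CL(X)$; when $d$ is bounded it is a metric on $CL(X)$, and $(CL(X),H_d)$ carries the topology induced by it. A topological space is completely metrizable if its topology is induced by a complete metric. A topological space is a Baire space if countable intersections of its dense open subsets are dense. Banach-Mazur game $BM(Z)$ on a topological space $Z$ with an open base $\mathcal{B}$ (one may take $\mathcal{B}$ to be all open sets; the notions below do not depend on this choice): players $\beta$ and $\alpha$ alternately choose nonempty members of $\mathcal{B}$, with $\beta$ starting. Player $\beta$ picks $V_0$, $\alpha$ responds with $U_0\subseteq V_0$, then $\beta$ picks $V_1\subseteq U_0$, $\alpha$ picks $U_1\subseteq V_1$, and so on. Player $\alpha$ wins the run $V_0,U_0,V_1,U_1,\dots$ if $\bigcap_n U_n=\bigcap_n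 V_n\neq\emptyset$; otherwise $\beta$ wins. A strategy for a player is a function assigning to each finite sequence of the opponent's previous choices a legal next move of that player; it is a winning strategy if the player wins every run compatible with it. $BM(Z)$ is $\alpha$-favorable (one also says $Z$ is $\alpha$-favorable in the Banach-Mazur game) if $\alpha$ has a winning strategy in $BM(Z)$. *)

theory Defs
  imports "HOL-Analysis.Analysis"
begin

section \<open>The hyperspace of closed sets with the Hausdorff distance\<close>

context Metric_space
begin

definition CL :: "'a set set" where
  "CL = {A. closedin mtopology A \<and> A \<noteq> {}}"

definition dist_to_set :: "'a \<Rightarrow> 'a set \<Rightarrow> real" where
  "dist_to_set x A = (INF a\<in>A. d x a)"

text \<open>
  The supremum is the intended one when the metric is bounded.  Outside \<open>CL\<close> the value is
  set to 0, because the locale \<open>Metric_space\<close> asks for nonnegativity and symmetry of the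
  distance function on the whole type.
\<close>
definition hausdorff_dist :: "'a set \<Rightarrow> 'a set \<Rightarrow> real" where
  "hausdorff_dist A B =
     (if A \<in> CL \<and> B \<in> CL then SUP x\<in>M. \<bar>dist_to_set x A - dist_to_set x B\<bar> else 0)"

definition hausdorff_topology :: "'a set topology" where
  "hausdorff_topology = Metric_space.mtopology CL hausdorff_dist"

lemma CL_subset: "A \<in> CL \<Longrightarrow> A \<subseteq> M"
  using closedin_subset by (fastforce simp: CL_def)

lemma dist_to_set_nonneg: "A \<in> CL \<Longrightarrow> 0 \<le> dist_to_set x A"
  unfolding dist_to_set_def by (rule cINF_greatest) (auto simp: CL_def)

lemma dist_to_set_le: "a \<in> A \<Longrightarrow> dist_to_set x A \<le> d x a"
  unfolding dist_to_set_def by (rule cINF_lower) (auto intro!: bdd_belowI[of _ 0])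

lemma dist_to_set_eq_0_iff:
  assumes A: "A \<in> CL" and x: "x \<in> M"
  shows "dist_to_set x A = 0 \<longleftrightarrow> x \<in> A"
proof
  assume "x \<in> A"
  then show "dist_to_set x A = 0"
    using dist_to_set_le[of x A x] dist_to_set_nonneg[OF A, of x] x by simp
next
  assume z: "dist_to_set x A = 0"
  show "x \<in> A"
  proof (rule ccontr)
    assume "x \<notin> A"
    moreover have "openin mtopology (M - A)"
      using A by (auto simp: CL_def closedin_def)
    ultimately obtain r where r: "r > 0" "mball x r \<subseteq> M - A"
      using x by (auto simp: openin_mtopology)
    have "r \<le> dist_to_set x A"
      unfolding dist_to_set_def
    proof (rule cINF_greatest)
      show "A \<noteq> {}" using A by (simp add: CL_def)
      show "r \<le> d x a" if "a \<in> A" for a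
        using r(2) that x CL_subset[OF A] by (force simp: mball_def)
    qed
    with z r(1) show False by simp
  qed
qed

theorem Metric_space_hausdorff:
  assumes "mbounded M"
  shows "Metric_space CL hausdorff_dist"
proof -
  obtain c C where C: "M \<subseteq> mcball c C"
    using assms by (auto simp: mbounded_def)
  have le: "d x y \<le> C + C" if "x \<in> M" "y \<in> M" for x y
  proof -
    have "c \<in> M" "d c x \<le> C" "d c y \<le> C" using C that by (auto simp: mcball_def)
    then show ?thesis using triangle[of x c y] commute[of x c] that by linarith
  qed
  have ub: "\<bar>dist_to_set x A - dist_to_set x B\<bar> \<le> C + C"
    if "A \<in> CL" "B \<in> CL" "x \<in> M" for A B x
  proof -
    obtain a b where "a \<in> A" "b \<in> B" using \<open>A \<in> CL\<close> \<open>B \<in> CL\<close> by (auto simp: CL_def)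
    moreover have "a \<in> M" "b \<in> M"
      using calculation CL_subset that by blast+
    ultimately show ?thesis
      using dist_to_set_le[of a A x] dist_to_set_le[of b B x] le[of x a] le[of x b]
        dist_to_set_nonneg[OF \<open>A \<in> CL\<close>, of x] dist_to_set_nonneg[OF \<open>B \<in> CL\<close>, of x] \<open>x \<in> M\<close>
      by linarith
  qed
  have bdd: "bdd_above ((\<lambda>x. \<bar>dist_to_set x A - dist_to_set x B\<bar>) ` M)"
    if "A \<in> CL" "B \<in> CL" for A B
    using ub[OF that] by (auto intro!: bdd_aboveI[of _ "C + C"])
  have up: "\<bar>dist_to_set x A - dist_to_set x B\<bar> \<le> hausdorff_dist A B"
    if "A \<in> CL" "B \<in> CL" "x \<in> M" for A B x
    using cSUP_upper[OF \<open>x \<in> M\<close> bdd[OF that(1,2)]] that by (simp add: hausdorff_dist_def)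
  have ne: "M \<noteq> {}" if "A \<in> CL" for A
    using CL_subset[OF that] that by (auto simp: CL_def)
  show ?thesis
  proof
    show "0 \<le> hausdorff_dist A B" for A B
    proof (cases "A \<in> CL \<and> B \<in> CL")
      case True
      then obtain x where "x \<in> M" using ne by blast
      then show ?thesis using up[of A B x] True by linarith
    qed (auto simp: hausdorff_dist_def)
    show "hausdorff_dist A B = hausdorff_dist B A" for A B
      by (auto simp: hausdorff_dist_def abs_minus_commute)
    show "hausdorff_dist A B = 0 \<longleftrightarrow> A = B" if AB: "A \<in> CL" "B \<in> CL" for A B
    proof
      assume "hausdorff_dist A B = 0"
      then have "dist_to_set x A = dist_to_set x B" if "x \<in> M" for x
        using up[OF AB that] by simp
      then show "A = B"
        using dist_to_set_eq_0_iff AB CL_subset by (metis subset_antisym subset_iff)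
    next
      assume "A = B"
      then show "hausdorff_dist A B = 0"
        using AB ne[OF AB(1)] by (simp add: hausdorff_dist_def)
    qed
    show "hausdorff_dist A D \<le> hausdorff_dist A B + hausdorff_dist B D"
      if "A \<in> CL" "B \<in> CL" "D \<in> CL" for A B D
    proof -
      have "(SUP x\<in>M. \<bar>dist_to_set x A - dist_to_set x D\<bar>)
              \<le> hausdorff_dist A B + hausdorff_dist B D"
      proof (rule cSUP_least)
        show "M \<noteq> {}" using ne that by blast
        show "\<bar>dist_to_set x A - dist_to_set x D\<bar> \<le> hausdorff_dist A B + hausdorff_dist B D"
          if "x \<in> M" for x
          using up[of A B x] up[of B D x] that \<open>A \<in> CL\<close> \<open>B \<in> CL\<close> \<open>D \<in> CL\<close> by linarith
      qed
      then show ?thesis using that by (simp add: hausdorff_dist_def)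
    qed
  qed
qed

end

section \<open>Baire spaces\<close>

text \<open>Intersecting with the whole space only matters for the empty family.\<close>
definition Baire_space :: "'a topology \<Rightarrow> bool" where
  "Baire_space T \<longleftrightarrow>
     (\<forall>\<G>. countable \<G> \<and> (\<forall>U\<in>\<G>. openin T U \<and> T closure_of U = topspace T)
        \<longrightarrow> T closure_of (topspace T \<inter> \<Inter>\<G>) = topspace T)"

section \<open>The Banach-Mazur game\<close>

text \<open>Both players choose from the base of all nonempty open sets.\<close>
definition BM_move :: "'a topology \<Rightarrow> 'a set \<Rightarrow> bool" where
  "BM_move T U \<longleftrightarrow> openin T U \<and> U \<noteq> {}"

text \<open>A run \<open>V 0, U 0, V 1, U 1, \<dots>\<close>; player \<open>\<beta>\<close> chooses the \<open>V n\<close> and player \<open>\<alpha>\<close> the \<open>U n\<close>.\<close>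
definition BM_run :: "'a topology \<Rightarrow> (nat \<Rightarrow> 'a set) \<Rightarrow> (nat \<Rightarrow> 'a set) \<Rightarrow> bool" where
  "BM_run T V U \<longleftrightarrow>
     (\<forall>n. BM_move T (V n) \<and> BM_move T (U n) \<and> U n \<subseteq> V n \<and> V (Suc n) \<subseteq> U n)"

text \<open>The intersections of the \<open>U n\<close> and of the \<open>V n\<close> agree in every run.\<close>
definition BM_alpha_wins :: "(nat \<Rightarrow> 'a set) \<Rightarrow> (nat \<Rightarrow> 'a set) \<Rightarrow> bool" where
  "BM_alpha_wins V U \<longleftrightarrow> (\<Inter>n. U n) \<noteq> {}"

text \<open>
  The list \<open>Vs\<close> is a legal sequence of previous choices of \<open>\<beta>\<close> (earliest first) when \<open>\<alpha>\<close> has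
  answered according to \<open>\<sigma>\<close>.
\<close>
definition BM_beta_choices :: "'a topology \<Rightarrow> ('a set list \<Rightarrow> 'a set) \<Rightarrow> 'a set list \<Rightarrow> bool" where
  "BM_beta_choices T \<sigma> Vs \<longleftrightarrow>
     (\<forall>V\<in>set Vs. BM_move T V) \<and>
     (\<forall>i. Suc i < length Vs \<longrightarrow> Vs ! Suc i \<subseteq> \<sigma> (take (Suc i) Vs))"

definition BM_alpha_strategy :: "'a topology \<Rightarrow> ('a set list \<Rightarrow> 'a set) \<Rightarrow> bool" where
  "BM_alpha_strategy T \<sigma> \<longleftrightarrow>
     (\<forall>Vs. Vs \<noteq> [] \<and> BM_beta_choices T \<sigma> Vs \<longrightarrow> BM_move T (\<sigma> Vs) \<and> \<sigma> Vs \<subseteq> last Vs)"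

definition BM_alpha_winning_strategy :: "'a topology \<Rightarrow> ('a set list \<Rightarrow> 'a set) \<Rightarrow> bool" where
  "BM_alpha_winning_strategy T \<sigma> \<longleftrightarrow>
     BM_alpha_strategy T \<sigma> \<and>
     (\<forall>V U. BM_run T V U \<and> (\<forall>n. U n = \<sigma> (map V [0..<Suc n])) \<longrightarrow> BM_alpha_wins V U)"

definition BM_alpha_favorable :: "'a topology \<Rightarrow> bool" where
  "BM_alpha_favorable T \<longleftrightarrow> (\<exists>\<sigma>. BM_alpha_winning_strategy T \<sigma>)"

end

theory Submission
  imports Defs
begin

text \<open>
  The space is a comb: for every index \<open>i\<close> in a set \<open>I\<close> there is one tooth, consisting of the
  points \<open>(i, n)\<close> at heights \<open>2\<^sup>-\<^sup>n\<close>.  On a tooth the distance is the difference of heights, and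
  points on different teeth have distance 1.  The topology is discrete, hence completely
  metrizable, and every nonempty subset is closed; but the metric is incomplete, because each
  tooth lacks its limit of height 0.

  The hyperspace has a dense set of isolated points.  A set whose heights are bounded away from
  0 consists of uniformly isolated points, so it is an isolated point of the hyperspace
  (\<open>isolated_if_height_bounded\<close>).  Every set is close to such a set: raise all its points below
  height \<open>2\<^sup>-\<^sup>N\<close> to that height (\<open>dense_isolated\<close>).  Player \<open>\<alpha>\<close> therefore wins by choosing an
  isolated singleton at once, and every dense open set contains all isolated points.

  For the closed copy of \<open>\<rat>\<close>, let \<open>I\<close> be a subset of the Cantor space of sets of naturals whose
  complement \<open>D\<close> is to be embedded.  With the metric \<open>\<rho>(x, y) = 2\<^sup>-\<^sup>k\<close>, where \<open>k\<close> is the first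
  place at which \<open>x\<close> and \<open>y\<close> differ, send \<open>z \<in> D\<close> to its profile: the set that has, on each tooth
  \<open>i\<close>, the single point of height \<open>\<rho>(i, z)\<close>.  When \<open>I\<close> is dense, the distance of two
  profiles measures how long \<open>x\<close> and \<open>y\<close> agree (\<open>hausdorff_dist_profile_le\<close> and
  \<open>agree_if_hausdorff_dist_profile_less\<close>), so this is an embedding.  It is closed
  (\<open>closedin_profile_image\<close>): a sequence in \<open>D\<close> whose profiles converge has a limit \<open>w\<close> in the
  Cantor space, and \<open>w \<in> I\<close> is impossible, since on the tooth \<open>w\<close> the heights of the profiles
  would tend to 0, where the comb has no point.

  Finally \<open>\<rat>\<close> embeds in the Cantor space by coding \<open>q\<close> as \<open>{n. q < r n}\<close> for a sequence \<open>r\<close> of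
  irrationals that is dense in the line, and the complement of the set of codes is dense
  (\<open>non_cuts_dense\<close>).  Complete metrizability is inherited by closed subspaces and
  fails for \<open>\<rat>\<close>, hence it fails for the hyperspace.
\<close>

section \<open>Games and category in the presence of dense isolated points\<close>

text \<open>
  After \<open>\<alpha>\<close> has answered the first move by a singleton, all later moves of both players are
  equal to that singleton.
\<close>
lemma BM_alpha_favorable_if_dense_isolated:
  assumes iso: "\<And>W. openin T W \<Longrightarrow> W \<noteq> {} \<Longrightarrow> \<exists>p\<in>W. openin T {p}"
  shows "BM_alpha_favorable T"
proof -
  define p where "p W = (SOME x. x \<in> W \<and> openin T {x})" for W
  have p: "p W \<in> W \<and> openin T {p W}" if "BM_move T W" for W
    unfolding p_def by (rule someI_ex) (use that iso[of W] in \<open>auto simp: BM_move_def\<close>)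
  define \<sigma> where "\<sigma> Vs = {p (last Vs)}" for Vs
  have "BM_alpha_strategy T \<sigma>"
    unfolding BM_alpha_strategy_def
  proof (intro allI impI)
    fix Vs assume "Vs \<noteq> [] \<and> BM_beta_choices T \<sigma> Vs"
    then have "BM_move T (last Vs)"
      by (simp add: BM_beta_choices_def)
    from p[OF this] show "BM_move T (\<sigma> Vs) \<and> \<sigma> Vs \<subseteq> last Vs"
      by (simp add: \<sigma>_def BM_move_def)
  qed
  moreover have "BM_alpha_wins V U"
    if run: "BM_run T V U" and U: "\<forall>n. U n = \<sigma> (map V [0..<Suc n])" for V U
  proof -
    have "U (Suc n) \<subseteq> U n" for n
      using run unfolding BM_run_def by (meson subset_trans)
    then have sub: "U n \<subseteq> U 0" for n
      by (metis lift_Suc_antimono_le le0)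
    have single: "U 0 = {p (V 0)}" and ne: "U n \<noteq> {}" for n
      using U by (simp_all add: \<sigma>_def)
    have "p (V 0) \<in> U n" for n
      using sub[of n] ne[of n] unfolding single by blast
    then show ?thesis
      by (auto simp: BM_alpha_wins_def)
  qed
  ultimately show ?thesis
    unfolding BM_alpha_favorable_def BM_alpha_winning_strategy_def by blast
qed

lemma Baire_space_if_dense_isolated:
  assumes iso: "\<And>W. openin T W \<Longrightarrow> W \<noteq> {} \<Longrightarrow> \<exists>p\<in>W. openin T {p}"
  shows "Baire_space T"
  unfolding Baire_space_def
proof (intro allI impI)
  fix \<G> assume \<G>: "countable \<G> \<and> (\<forall>U\<in>\<G>. openin T U \<and> T closure_of U = topspace T)"
  have mem: "p \<in> U" if p: "openin T {p}" and U: "U \<in> \<G>" for p U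
  proof -
    have "T closure_of U = topspace T"
      using \<G> U by blast
    then have "\<forall>W. openin T W \<and> W \<noteq> {} \<longrightarrow> U \<inter> W \<noteq> {}"
      by (simp add: dense_intersects_open)
    then have "U \<inter> {p} \<noteq> {}"
      using p by (metis insert_not_empty)
    then show ?thesis
      by blast
  qed
  have "(topspace T \<inter> \<Inter>\<G>) \<inter> W \<noteq> {}" if W: "openin T W" "W \<noteq> {}" for W
  proof -
    obtain p where "p \<in> W" "openin T {p}"
      using iso[OF W] by blast
    moreover have "p \<in> topspace T"
      using openin_subset[OF W(1)] \<open>p \<in> W\<close> by blast
    ultimately show ?thesis
      using mem by blast
  qed
  then show "T closure_of (topspace T \<inter> \<Inter>\<G>) = topspace T"
    by (subst dense_intersects_open) (metis Int_commute)
qed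

section \<open>Metric spaces\<close>

text \<open>
  The second estimate yields injectivity of \<open>f\<close> as well as continuity of its inverse.
\<close>
lemma homeomorphic_onto_image_metric:
  assumes M1: "Metric_space M1 d1" and M2: "Metric_space M2 d2"
    and f: "f ` M1 \<subseteq> M2"
    and cont: "\<And>a \<epsilon>. a \<in> M1 \<Longrightarrow> \<epsilon> > 0 \<Longrightarrow> \<exists>\<delta>>0. \<forall>x\<in>M1. d1 a x < \<delta> \<longrightarrow> d2 (f a) (f x) < \<epsilon>"
    and inv: "\<And>a \<epsilon>. a \<in> M1 \<Longrightarrow> \<epsilon> > 0 \<Longrightarrow> \<exists>\<delta>>0. \<forall>x\<in>M1. d2 (f a) (f x) < \<delta> \<longrightarrow> d1 a x < \<epsilon>"
  shows "Metric_space.mtopology M1 d1 homeomorphic_space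
           subtopology (Metric_space.mtopology M2 d2) (f ` M1)"
proof -
  interpret M1: Metric_space M1 d1 by fact
  interpret M2: Metric_space M2 d2 by fact
  interpret S: Submetric M2 d2 "f ` M1"
    using f by unfold_locales
  have inj: "inj_on f M1"
  proof (rule inj_onI)
    fix a x assume ax: "a \<in> M1" "x \<in> M1" "f a = f x"
    have "d1 a x < \<epsilon>" if "\<epsilon> > 0" for \<epsilon>
      using inv[OF ax(1) that] ax f by fastforce
    then have "d1 a x = 0"
      using M1.nonneg[of a x] by (metis less_irrefl linorder_not_le nle_le)
    then show "a = x"
      using ax by simp
  qed
  have "continuous_map M1.mtopology S.sub.mtopology f"
    unfolding M1.metric_continuous_map[OF S.sub.Metric_space_axioms]
    using cont by blast
  moreover have "continuous_map S.sub.mtopology M1.mtopology (inv_into M1 f)"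
    unfolding S.sub.metric_continuous_map[OF M1.Metric_space_axioms]
  proof (intro conjI ballI allI impI)
    fix b and \<epsilon> :: real assume b: "b \<in> f ` M1" "\<epsilon> > 0"
    then obtain a where a: "a \<in> M1" "b = f a" by blast
    with inv[OF a(1) b(2)] inj
    show "\<exists>\<delta>>0. \<forall>x. x \<in> f ` M1 \<and> d2 b x < \<delta> \<longrightarrow>
        d1 (inv_into M1 f b) (inv_into M1 f x) < \<epsilon>"
      by (metis imageE inv_into_f_f)
  qed (auto simp: inj)
  ultimately have "homeomorphic_maps M1.mtopology S.sub.mtopology f (inv_into M1 f)"
    by (simp add: homeomorphic_maps_def inj f_inv_into_f)
  then show ?thesis
    using S.mtopology_submetric homeomorphic_space_def by metis
qed

context Metric_space
begin

text \<open>
  This and the next lemma replace the supremum over all base points by the usual description: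
  each of the two sets lies in a small neighbourhood of the other one.  Here the base point \<open>a\<close>
  itself is used, at which the distance to \<open>A\<close> vanishes; boundedness of the metric makes the
  supremum dominate the value there.
\<close>
lemma hausdorff_dist_less_imp_near:
  assumes bd: "mbounded M" and A: "A \<in> CL" and B: "B \<in> CL"
    and less: "hausdorff_dist A B < \<delta>" and a: "a \<in> A"
  shows "\<exists>b\<in>B. d a b < \<delta>"
proof -
  obtain K where K: "d x y \<le> K" if "x \<in> M" "y \<in> M" for x y
    using bd by (auto simp: mbounded_alt)
  have aM: "a \<in> M"
    using a A CL_subset by blast
  have range: "0 \<le> dist_to_set x C \<and> dist_to_set x C \<le> K" if C: "C \<in> CL" and x: "x \<in> M" for x C
  proof -
    obtain c where "c \<in> C" using C by (auto simp: CL_def)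
    then show ?thesis
      using dist_to_set_le[of c C x] K[of x c] dist_to_set_nonneg[OF C] CL_subset[OF C] x by force
  qed
  have "\<bar>dist_to_set x A - dist_to_set x B\<bar> \<le> K" if "x \<in> M" for x
    using range[OF A that] range[OF B that] by linarith
  then have "bdd_above ((\<lambda>x. \<bar>dist_to_set x A - dist_to_set x B\<bar>) ` M)"
    by (auto intro!: bdd_aboveI[of _ K])
  from cSUP_upper[OF aM this] have "\<bar>dist_to_set a A - dist_to_set a B\<bar> \<le> hausdorff_dist A B"
    using A B by (simp add: hausdorff_dist_def)
  moreover have "dist_to_set a A = 0"
    using dist_to_set_eq_0_iff[OF A aM] a by simp
  ultimately have "dist_to_set a B < \<delta>"
    using less by linarith
  moreover have "B \<noteq> {}"
    using B by (simp add: CL_def)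
  ultimately show ?thesis
    unfolding dist_to_set_def by (subst (asm) cINF_less_iff) (auto intro!: bdd_belowI[of _ 0])
qed

lemma hausdorff_dist_le:
  assumes A: "A \<in> CL" and B: "B \<in> CL"
    and AB: "\<And>a. a \<in> A \<Longrightarrow> \<exists>b\<in>B. d a b \<le> \<delta>" and BA: "\<And>b. b \<in> B \<Longrightarrow> \<exists>a\<in>A. d b a \<le> \<delta>"
  shows "hausdorff_dist A B \<le> \<delta>"
proof -
  have one: "dist_to_set x C' \<le> dist_to_set x C + \<delta>"
    if "C \<in> CL" "C' \<in> CL" "x \<in> M" and near: "\<And>c. c \<in> C \<Longrightarrow> \<exists>c'\<in>C'. d c c' \<le> \<delta>" for C C' x
  proof -
    have "dist_to_set x C' - \<delta> \<le> d x c" if c: "c \<in> C" for c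
    proof -
      obtain c' where c': "c' \<in> C'" "d c c' \<le> \<delta>"
        using near[OF c] by blast
      then have "d x c' \<le> d x c + d c c'"
        using c \<open>C \<in> CL\<close> \<open>C' \<in> CL\<close> \<open>x \<in> M\<close> CL_subset by (blast intro: triangle)
      then show ?thesis
        using dist_to_set_le[OF c'(1), of x] c'(2) by linarith
    qed
    then have "dist_to_set x C' - \<delta> \<le> dist_to_set x C"
      using \<open>C \<in> CL\<close> unfolding dist_to_set_def[of x C] by (intro cINF_greatest) (auto simp: CL_def)
    then show ?thesis by linarith
  qed
  have "M \<noteq> {}"
    using A CL_subset[OF A] by (auto simp: CL_def)
  then have "(SUP x\<in>M. \<bar>dist_to_set x A - dist_to_set x B\<bar>) \<le> \<delta>"
    using one[OF A B _ AB] one[OF B A _ BA] by (intro cSUP_least) (auto simp: abs_le_iff algebra_simps)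
  then show ?thesis
    using A B by (simp add: hausdorff_dist_def)
qed

end

section \<open>The comb, a discrete space with incomplete teeth\<close>

text \<open>
  The points are labelled by an injection \<open>pt\<close> into an arbitrary type, so that the comb can be
  realised on a set of real numbers.
\<close>
locale comb =
  fixes I :: "'i set" and pt :: "'i \<times> nat \<Rightarrow> 'a"
  assumes inj_pt: "inj pt"
begin

definition carrier :: "'a set" where
  "carrier = pt ` (I \<times> UNIV)"

definition cdist :: "'a \<Rightarrow> 'a \<Rightarrow> real" where
  "cdist x y = (case inv pt x of (i, m) \<Rightarrow> case inv pt y of (j, n) \<Rightarrow>
     if i = j then \<bar>(1/2)^m - (1/2)^n\<bar> else 1)"

lemma cdist_pt [simp]:
  "cdist (pt (i, m)) (pt (j, n)) = (if i = j then \<bar>(1/2)^m - (1/2)^n\<bar> else 1)"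
  by (simp add: cdist_def inj_pt)

lemma pt_eq_iff [simp]: "pt u = pt v \<longleftrightarrow> u = v"
  using inj_pt by (auto dest: injD)

lemma pt_in_carrier [simp]: "pt (i, n) \<in> carrier \<longleftrightarrow> i \<in> I"
  by (auto simp: carrier_def)

lemma carrierE:
  assumes "x \<in> carrier"
  obtains i n where "i \<in> I" "x = pt (i, n)"
  using assms by (auto simp: carrier_def)

lemma abs_half_powers_le: "\<bar>(1/2)^m - (1/2)^n\<bar> \<le> (1::real)"
proof -
  have "0 \<le> (1/2::real)^k \<and> (1/2::real)^k \<le> 1" for k
    by (simp add: power_le_one)
  from this[of m] this[of n] show ?thesis by linarith
qed

lemma cdist_le_1: "cdist x y \<le> 1"
  by (auto simp: cdist_def abs_half_powers_le split: prod.split)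

text \<open>
  The nearest neighbour of the point of height \<open>2\<^sup>-\<^sup>n\<close> is the one just below it, at distance
  exactly \<open>2\<^sup>-\<^sup>(\<^sup>n\<^sup>+\<^sup>1\<^sup>)\<close>.  All separation arguments on the comb rest on this.
\<close>
lemma near_imp_eq:
  assumes "cdist (pt (i, n)) (pt (j, m)) < (1/2)^Suc n"
  shows "j = i \<and> m = n"
proof -
  have "(1/2::real)^Suc n \<le> 1"
    by (rule power_le_one) auto
  with assms have ij: "j = i"
    by (auto split: if_splits)
  have "m = n"
  proof (rule ccontr)
    assume "m \<noteq> n"
    then consider "Suc n \<le> m" | "Suc m \<le> n" by linarith
    then have "(1/2)^Suc n \<le> \<bar>(1/2)^n - (1/2::real)^m\<bar>"
    proof cases
      case 1
      then have "(1/2::real)^m \<le> (1/2)^Suc n"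
        by (intro power_decreasing) auto
      then show ?thesis unfolding power_Suc by linarith
    next
      case 2
      then have "(1/2::real)^n \<le> (1/2)^Suc m"
        by (intro power_decreasing) auto
      then show ?thesis unfolding power_Suc using zero_le_power[of "1/2::real" n] by linarith
    qed
    with assms ij show False by simp
  qed
  with ij show ?thesis by simp
qed

lemma Metric_space_comb: "Metric_space carrier cdist"
proof
  show "0 \<le> cdist x y" for x y
    by (auto simp: cdist_def split: prod.split)
  show "cdist x y = cdist y x" for x y
    by (auto simp: cdist_def abs_minus_commute split: prod.split)
  show "cdist x y = 0 \<longleftrightarrow> x = y" if "x \<in> carrier" "y \<in> carrier" for x y
  proof
    obtain i m j n where xy: "x = pt (i, m)" "y = pt (j, n)"
      using \<open>x \<in> carrier\<close> \<open>y \<in> carrier\<close> by (meson carrierE)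
    assume "cdist x y = 0"
    then show "x = y"
      using near_imp_eq[of i m j n] by (simp add: xy del: cdist_pt)
  next
    assume "x = y"
    then show "cdist x y = 0"
      by (simp add: cdist_def split: prod.split)
  qed
  show "cdist x z \<le> cdist x y + cdist y z"
    if "x \<in> carrier" "y \<in> carrier" "z \<in> carrier" for x y z
  proof -
    obtain i k j m l n where xyz: "x = pt (i, k)" "y = pt (j, m)" "z = pt (l, n)"
      using \<open>x \<in> carrier\<close> \<open>y \<in> carrier\<close> \<open>z \<in> carrier\<close> by (metis carrierE)
    have "\<bar>(1/2)^k - (1/2)^n\<bar> \<le> \<bar>(1/2)^k - (1/2)^m\<bar> + \<bar>(1/2)^m - (1/2::real)^n\<bar>"
      by linarith
    moreover have "\<bar>(1/2)^k - (1/2)^n\<bar> \<le> (1::real)"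
      by (rule abs_half_powers_le)
    ultimately show ?thesis
      by (auto simp: xyz)
  qed
qed

sublocale X: Metric_space carrier cdist
  by (rule Metric_space_comb)

lemma mbounded_comb: "X.mbounded carrier"
  using cdist_le_1 by (auto simp: X.mbounded_alt)

lemma mtopology_comb: "X.mtopology = discrete_topology carrier"
proof -
  have "openin X.mtopology {x}" if x: "x \<in> carrier" for x
  proof -
    obtain i n where "i \<in> I" "x = pt (i, n)"
      using x by (rule carrierE)
    then have "X.mball x ((1/2)^Suc n) = {x}"
      by (auto simp del: cdist_pt power_Suc elim!: carrierE dest: near_imp_eq)
    then show ?thesis
      by (metis X.openin_mball)
  qed
  then show ?thesis
    by (metis X.topspace_mtopology discrete_topology_unique)
qed

lemma CL_comb: "X.CL = {A. A \<subseteq> carrier \<and> A \<noteq> {}}"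
  by (auto simp: X.CL_def mtopology_comb)

sublocale H: Metric_space X.CL X.hausdorff_dist
  by (rule X.Metric_space_hausdorff[OF mbounded_comb])

lemma near_point:
  assumes "A \<in> X.CL" "B \<in> X.CL" "X.hausdorff_dist A B < (1/2)^Suc n" "pt (i, n) \<in> A"
  shows "pt (i, n) \<in> B"
proof -
  obtain b where b: "b \<in> B" "cdist (pt (i, n)) b < (1/2)^Suc n"
    using X.hausdorff_dist_less_imp_near[OF mbounded_comb assms] by blast
  then obtain j m where "b = pt (j, m)"
    using X.CL_subset[OF assms(2)] carrierE by blast
  with b near_imp_eq show ?thesis by blast
qed

text \<open>
  All points of \<open>A\<close> are isolated with the same radius \<open>2\<^sup>-\<^sup>(\<^sup>N\<^sup>+\<^sup>1\<^sup>)\<close>, so a set closer to \<open>A\<close> than this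
  can neither miss a point of \<open>A\<close> nor have a point outside \<open>A\<close>.
\<close>
lemma isolated_if_height_bounded:
  assumes A: "A \<in> X.CL" and low: "\<And>i n. pt (i, n) \<in> A \<Longrightarrow> n \<le> N"
  shows "openin X.hausdorff_topology {A}"
proof -
  have eq: "B = A" if B: "B \<in> X.CL" and AB: "X.hausdorff_dist A B < (1/2)^Suc N" for B
  proof
    show "A \<subseteq> B"
    proof
      fix x assume x: "x \<in> A"
      then obtain i n where n: "x = pt (i, n)"
        using X.CL_subset[OF A] carrierE by blast
      have "(1/2::real)^Suc N \<le> (1/2)^Suc n"
        using low x n by (intro power_decreasing) auto
      then show "x \<in> B"
        using near_point[OF A B] AB x n by (meson less_le_trans)
    qed
    show "B \<subseteq> A"
    proof
      fix x assume x: "x \<in> B"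
      have "X.hausdorff_dist B A < (1/2)^Suc N"
        using AB by (simp add: H.commute)
      then obtain a where a: "a \<in> A" "cdist x a < (1/2)^Suc N"
        using X.hausdorff_dist_less_imp_near[OF mbounded_comb B A _ x] by blast
      obtain i n j m where n: "x = pt (i, n)" "a = pt (j, m)"
        using X.CL_subset[OF A] X.CL_subset[OF B] a x by (meson carrierE subsetD)
      have "(1/2::real)^Suc N \<le> (1/2)^Suc m"
        using low a n by (intro power_decreasing) auto
      then have "cdist (pt (j, m)) (pt (i, n)) < (1/2)^Suc m"
        using a n X.commute by (metis less_le_trans)
      then show "x \<in> A"
        using near_imp_eq a n by blast
    qed
  qed
  have "B \<in> {A}" if "B \<in> H.mball A ((1/2)^Suc N)" for B
    using eq[of B] that unfolding H.in_mball by blast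
  moreover have "A \<in> H.mball A ((1/2)^Suc N)"
    using A by simp
  ultimately have "H.mball A ((1/2)^Suc N) = {A}"
    by blast
  then show ?thesis
    unfolding X.hausdorff_topology_def by (metis H.openin_mball)
qed

lemma dense_isolated:
  assumes W: "openin X.hausdorff_topology W" and ne: "W \<noteq> {}"
  shows "\<exists>A\<in>W. openin X.hausdorff_topology {A}"
proof -
  obtain A where A: "A \<in> W" using ne by blast
  then obtain r where r: "r > 0" "H.mball A r \<subseteq> W"
    using W by (auto simp: X.hausdorff_topology_def H.openin_mtopology)
  have ACL: "A \<in> X.CL"
    using W A openin_subset by (fastforce simp: X.hausdorff_topology_def)
  obtain N where N: "(1/2::real)^N < r"
    using real_arch_pow_inv[OF r(1), of "1/2"] by auto
  \<comment> \<open>Raising the points below height 2^-N to that height moves them by less than 2^-N.\<close>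
  define B where "B = {pt (i, min n N) | i n. pt (i, n) \<in> A}"
  have shape: "\<exists>i n. a = pt (i, n)" if "a \<in> A" for a
    using that X.CL_subset[OF ACL] carrierE by blast
  have BCL: "B \<in> X.CL"
    using ACL shape by (fastforce simp: CL_comb B_def)
  have close: "cdist (pt (i, n)) (pt (i, min n N)) \<le> (1/2)^N" for i n
  proof (cases "n \<le> N")
    case False
    then have "(1/2::real)^n \<le> (1/2)^N"
      by (intro power_decreasing) auto
    with False show ?thesis
      by (simp add: min_def)
  qed simp
  have "X.hausdorff_dist A B \<le> (1/2)^N"
  proof (rule X.hausdorff_dist_le[OF ACL BCL])
    show "\<exists>b\<in>B. cdist a b \<le> (1/2)^N" if "a \<in> A" for a
      using shape[OF that] that close unfolding B_def by blast
    show "\<exists>a\<in>A. cdist b a \<le> (1/2)^N" if "b \<in> B" for b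
    proof -
      obtain i n where "b = pt (i, min n N)" "pt (i, n) \<in> A"
        using \<open>b \<in> B\<close> by (auto simp: B_def)
      with close[of i n] show ?thesis
        using X.commute by (intro bexI[of _ "pt (i, n)"]) auto
    qed
  qed
  then have "B \<in> W"
    using N r ACL BCL by auto
  moreover have "openin X.hausdorff_topology {B}"
    by (rule isolated_if_height_bounded[OF BCL, of N]) (auto simp: B_def)
  ultimately show ?thesis
    by blast
qed

end

section \<open>Closed copies of subsets of the Cantor space\<close>

definition agree :: "nat \<Rightarrow> nat set \<Rightarrow> nat set \<Rightarrow> bool" where
  "agree n x y \<longleftrightarrow> (\<forall>k<n. k \<in> x \<longleftrightarrow> k \<in> y)"

definition first_diff :: "nat set \<Rightarrow> nat set \<Rightarrow> nat" where
  "first_diff x y = (LEAST n. (n \<in> x) \<noteq> (n \<in> y))"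

text \<open>
  For \<open>x = y\<close> there is no place of difference, so \<open>first_diff x y\<close> is an unspecified number, whereas
  \<open>agree n x y\<close> holds for every \<open>n\<close>; hence the hypothesis.
\<close>
lemma agree_iff_le_first_diff:
  assumes "x \<noteq> y"
  shows "agree n x y \<longleftrightarrow> n \<le> first_diff x y"
proof -
  have ex: "\<exists>n. (n \<in> x) \<noteq> (n \<in> y)"
    using assms by blast
  have "(first_diff x y \<in> x) \<noteq> (first_diff x y \<in> y)"
    unfolding first_diff_def by (rule LeastI_ex[OF ex])
  moreover have "(k \<in> x) = (k \<in> y)" if "k < first_diff x y" for k
    using that not_less_Least unfolding first_diff_def by blast
  ultimately show ?thesis
    unfolding agree_def by (meson less_le_trans not_le)
qed

lemma first_diff_eqI:
  assumes "agree k x y" "(k \<in> x) \<noteq> (k \<in> y)"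
  shows "first_diff x y = k"
  unfolding first_diff_def using assms
  by (intro Least_equality) (auto simp: agree_def not_less[symmetric])

lemma agree_sym: "agree n x y \<Longrightarrow> agree n y x"
  by (auto simp: agree_def)

lemma agree_trans: "agree n x y \<Longrightarrow> agree n y z \<Longrightarrow> agree n x z"
  by (auto simp: agree_def)

locale cantor_comb = comb I pt for I :: "nat set set" and pt :: "nat set \<times> nat \<Rightarrow> 'a" +
  assumes dense: "\<exists>i\<in>I. agree n i y"
begin

text \<open>
  The distance function of the Cantor space from \<open>z\<close>, restricted to \<open>I\<close> and written as a subset of
  the comb.  It has this meaning for \<open>z \<notin> I\<close>; for \<open>z \<in> I\<close> the height on the tooth \<open>z\<close> would have to be
  0, and the actual point there is a junk value.
\<close>
definition profile :: "nat set \<Rightarrow> 'a set" where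
  "profile z = {pt (i, first_diff i z) | i. i \<in> I}"

lemma pt_in_profile: "pt (i, n) \<in> profile z \<longleftrightarrow> i \<in> I \<and> n = first_diff i z"
  by (auto simp: profile_def)

lemma profile_CL: "profile z \<in> X.CL"
  using dense[of 0 z] by (auto simp: CL_comb profile_def)

text \<open>
  If \<open>i\<close> differs from \<open>x\<close> at a place before \<open>n\<close>, then it first differs from \<open>y\<close> at the same place as
  from \<open>x\<close>, so both profiles agree on the tooth \<open>i\<close>; on any other tooth both heights are at most \<open>2\<^sup>-\<^sup>n\<close>.
\<close>
lemma hausdorff_dist_profile_le:
  assumes xy: "x \<notin> I" "y \<notin> I" and agr: "agree n x y"
  shows "X.hausdorff_dist (profile x) (profile y) \<le> (1/2)^n"
proof -
  have *: "cdist (pt (i, first_diff i u)) (pt (i, first_diff i v)) \<le> (1/2)^n"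
    if i: "i \<in> I" and uv: "u \<notin> I" "v \<notin> I" and agr: "agree n u v" for i u v
  proof -
    have ne: "i \<noteq> u" "i \<noteq> v"
      using i uv by auto
    show ?thesis
    proof (cases "agree n i u")
      case True
      then have "agree n i v"
        using agr agree_trans by blast
      then have "n \<le> first_diff i u" "n \<le> first_diff i v"
        using True ne agree_iff_le_first_diff by blast+
      then have "(1/2::real)^first_diff i u \<le> (1/2)^n" "(1/2::real)^first_diff i v \<le> (1/2)^n"
        by (auto intro!: power_decreasing simp del: power_divide)
      moreover have "0 \<le> (1/2::real)^first_diff i u" "0 \<le> (1/2::real)^first_diff i v"
        by simp_all
      ultimately have "\<bar>(1/2)^first_diff i u - (1/2)^first_diff i v\<bar> \<le> (1/2::real)^n"
        by linarith
      then show ?thesis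
        by simp
    next
      case False
      then have less: "first_diff i u < n"
        using agree_iff_le_first_diff[OF ne(1)] by simp
      let ?k = "first_diff i u"
      have "agree ?k i u" "\<not> agree (Suc ?k) i u"
        using agree_iff_le_first_diff[OF ne(1)] by auto
      then have "agree ?k i v" "(?k \<in> i) \<noteq> (?k \<in> v)"
        using agr less by (auto simp: agree_def less_Suc_eq)
      then have "first_diff i v = ?k"
        by (rule first_diff_eqI)
      then show ?thesis by simp
    qed
  qed
  show ?thesis
  proof (rule X.hausdorff_dist_le[OF profile_CL profile_CL])
    show "\<exists>b\<in>profile y. cdist a b \<le> (1/2)^n" if "a \<in> profile x" for a
      using that *[OF _ xy agr] by (fastforce simp: profile_def simp del: cdist_pt)
    show "\<exists>a\<in>profile x. cdist b a \<le> (1/2)^n" if "b \<in> profile y" for b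
      using that *[OF _ xy(2,1) agree_sym[OF agr]] by (fastforce simp: profile_def simp del: cdist_pt)
  qed
qed

text \<open>
  If \<open>x\<close> and \<open>y\<close> first differ at place \<open>k < n\<close>, density provides a tooth that follows \<open>y\<close> beyond
  place \<open>k\<close>.  On it the profile of \<open>x\<close> has height \<open>2\<^sup>-\<^sup>k\<close> and that of \<open>y\<close> is lower, which forces a
  distance of at least \<open>2\<^sup>-\<^sup>(\<^sup>k\<^sup>+\<^sup>1\<^sup>)\<close>.
\<close>
lemma agree_if_hausdorff_dist_profile_less:
  assumes xy: "x \<notin> I" "y \<notin> I" and less: "X.hausdorff_dist (profile x) (profile y) < (1/2)^n"
  shows "agree n x y"
proof (rule ccontr)
  assume nag: "\<not> agree n x y"
  then have "x \<noteq> y"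
    by (auto simp: agree_def)
  define k where "k = first_diff x y"
  have k: "k < n" "agree k x y" "\<not> agree (Suc k) x y"
    using nag agree_iff_le_first_diff[OF \<open>x \<noteq> y\<close>] by (auto simp: k_def)
  obtain i where i: "i \<in> I" "agree (Suc k) i y"
    using dense by blast
  have "agree k i x" "(k \<in> i) \<noteq> (k \<in> x)"
    using i k by (auto simp: agree_def less_Suc_eq)
  then have "first_diff i x = k"
    by (rule first_diff_eqI)
  then have "pt (i, k) \<in> profile x"
    using i by (simp add: pt_in_profile)
  moreover have "(1/2::real)^n \<le> (1/2)^Suc k"
    using k(1) by (intro power_decreasing) auto
  ultimately have "pt (i, k) \<in> profile y"
    using near_point[OF profile_CL profile_CL] less by (meson less_le_trans)
  then have "first_diff i y = k"
    by (simp add: pt_in_profile)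
  moreover have "i \<noteq> y"
    using i xy by blast
  ultimately show False
    using i(2) agree_iff_le_first_diff[of i y "Suc k"] by simp
qed

text \<open>
  Convergence of the profiles makes the codes \<open>z n\<close> converge place by place to some \<open>w\<close>.  If
  \<open>w \<in> I\<close>, the limit set \<open>A\<close> would meet the tooth \<open>w\<close> in a point, which by \<open>near_point\<close> would belong
  to the profile of \<open>z n\<close> for all large \<open>n\<close>, although the heights of those profiles on the tooth \<open>w\<close>
  tend to 0.  So \<open>w \<notin> I\<close>, and then \<open>A\<close> is the profile of \<open>w\<close>.
\<close>
lemma closedin_profile_image: "closedin X.hausdorff_topology (profile ` (- I))"
  unfolding X.hausdorff_topology_def H.metric_closedin_iff_sequentially_closed
proof (intro conjI allI impI)
  show "profile ` (- I) \<subseteq> X.CL"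
    using profile_CL by blast
next
  fix \<sigma> A assume \<sigma>: "range \<sigma> \<subseteq> profile ` (- I) \<and> limitin H.mtopology \<sigma> A sequentially"
  then have "\<forall>n. \<exists>z. z \<notin> I \<and> \<sigma> n = profile z"
    by blast
  then obtain z where z: "\<And>n. z n \<notin> I" "\<And>n. \<sigma> n = profile (z n)"
    by metis
  have A: "A \<in> X.CL"
    using \<sigma> by (simp add: H.limit_metric_sequentially)
  have lim: "\<forall>\<^sub>F n in sequentially. X.hausdorff_dist (profile (z n)) A < \<epsilon>" if "\<epsilon> > 0" for \<epsilon>
  proof -
    have "\<forall>\<epsilon>>0. \<exists>N. \<forall>n\<ge>N. \<sigma> n \<in> X.CL \<and> X.hausdorff_dist (\<sigma> n) A < \<epsilon>"
      using \<sigma> unfolding H.limit_metric_sequentially by (elim conjE)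
    then obtain N where "\<forall>n\<ge>N. X.hausdorff_dist (\<sigma> n) A < \<epsilon>"
      using \<open>\<epsilon> > 0\<close> by metis
    then show ?thesis
      by (auto simp: eventually_sequentially z(2))
  qed
  \<comment> \<open>Two sets within 2^-(k+2) of A are within 2^-(k+1) of each other, which settles place k.\<close>
  have "\<exists>b. \<forall>\<^sub>F n in sequentially. (k \<in> z n) = b" for k
  proof -
    obtain N where N: "\<And>n. n \<ge> N \<Longrightarrow> X.hausdorff_dist (profile (z n)) A < (1/2)^(k+2)"
      using lim[of "(1/2)^(k+2)"] by (auto simp: eventually_sequentially)
    have "(k \<in> z n) = (k \<in> z N)" if n: "n \<ge> N" for n
    proof -
      have "X.hausdorff_dist (profile (z n)) (profile (z N))
          \<le> X.hausdorff_dist (profile (z n)) A + X.hausdorff_dist (profile (z N)) A"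
        using H.triangle[OF profile_CL A profile_CL] by (metis H.commute)
      also have "\<dots> < (1/2)^(k+2) + (1/2)^(k+2)"
        using N n by (intro add_strict_mono) auto
      also have "\<dots> = (1/2)^Suc k"
        by simp
      finally have "agree (Suc k) (z n) (z N)"
        by (rule agree_if_hausdorff_dist_profile_less[OF z(1) z(1)])
      then show ?thesis
        by (simp add: agree_def)
    qed
    then show ?thesis
      unfolding eventually_sequentially by blast
  qed
  then obtain b where b: "\<And>k. \<forall>\<^sub>F n in sequentially. (k \<in> z n) = b k"
    by metis
  define w where "w = Collect b"
  have conv: "\<forall>\<^sub>F n in sequentially. agree k (z n) w" for k
  proof -
    have "\<forall>\<^sub>F n in sequentially. \<forall>j\<in>{..<k}. (j \<in> z n) = b j"
      by (intro eventually_ball_finite) (auto simp: b)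
    then show ?thesis
      by eventually_elim (auto simp: agree_def w_def)
  qed
  have "w \<notin> I"
  proof
    assume w: "w \<in> I"
    \<comment> \<open>Distance less than 1 keeps the nearby point of A on the tooth w.\<close>
    obtain n0 where n0: "X.hausdorff_dist (profile (z n0)) A < 1"
      using eventually_happens'[OF _ lim[of 1]] by auto
    have "pt (w, first_diff w (z n0)) \<in> profile (z n0)"
      using w by (simp add: pt_in_profile)
    then obtain a where a: "a \<in> A" "cdist (pt (w, first_diff w (z n0))) a < 1"
      using X.hausdorff_dist_less_imp_near[OF mbounded_comb profile_CL A n0] by blast
    then obtain j m where "a = pt (j, m)"
      using X.CL_subset[OF A] carrierE by blast
    with a have m: "pt (w, m) \<in> A"
      by (auto split: if_splits)
    have "\<forall>\<^sub>F n in sequentially. X.hausdorff_dist (profile (z n)) A < (1/2)^Suc m \<and> agree (Suc m) (z n) w"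
      using lim[of "(1/2)^Suc m"] conv by (intro eventually_conj) auto
    then obtain n where n: "X.hausdorff_dist (profile (z n)) A < (1/2)^Suc m" "agree (Suc m) (z n) w"
      using eventually_happens' sequentially_bot by blast
    then have "pt (w, m) \<in> profile (z n)"
      using near_point[OF A profile_CL _ m] by (metis H.commute)
    then have "first_diff w (z n) = m"
      by (simp add: pt_in_profile)
    moreover have "w \<noteq> z n"
      using w z by blast
    ultimately show False
      using agree_iff_le_first_diff[of w "z n" "Suc m"] agree_sym[OF n(2)] by simp
  qed
  moreover have "A = profile w"
  proof -
    have "X.hausdorff_dist A (profile w) < \<epsilon>" if "\<epsilon> > 0" for \<epsilon>
    proof -
      obtain k where k: "(1/2::real)^k < \<epsilon>/2"
        using real_arch_pow_inv[of "\<epsilon>/2" "1/2"] \<open>\<epsilon> > 0\<close> by auto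
      have "\<forall>\<^sub>F n in sequentially. X.hausdorff_dist (profile (z n)) A < \<epsilon>/2 \<and> agree k (z n) w"
        using lim[of "\<epsilon>/2"] conv \<open>\<epsilon> > 0\<close> by (intro eventually_conj) auto
      then obtain n where n: "X.hausdorff_dist (profile (z n)) A < \<epsilon>/2" "agree k (z n) w"
        using eventually_happens' sequentially_bot by blast
      have "X.hausdorff_dist (profile (z n)) (profile w) \<le> (1/2)^k"
        using hausdorff_dist_profile_le[OF z(1) \<open>w \<notin> I\<close> n(2)] .
      then show ?thesis
        using n(1) k H.triangle[OF A profile_CL[of "z n"] profile_CL[of w]] H.commute[of A "profile (z n)"]
        by linarith
    qed
    then have "X.hausdorff_dist A (profile w) = 0"
      using H.nonneg[of A "profile w"] by (metis less_irrefl linorder_not_le nle_le)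
    then show ?thesis
      using A profile_CL by simp
  qed
  ultimately show "A \<in> profile ` (- I)"
    by blast
qed

end

section \<open>The rationals\<close>

text \<open>
  The rationals are countable and without isolated points, but a nonempty perfect completely metrizable space has at least the cardinality of the continuum.
\<close>
lemma rationals_not_completely_metrizable: "\<not> completely_metrizable_space (top_of_set (\<rat> :: real set))"
proof
  assume cm: "completely_metrizable_space (top_of_set (\<rat> :: real set))"
  have "top_of_set \<rat> derived_set_of \<rat> = (\<rat> :: real set)"
  proof -
    have "q islimpt \<rat>" for q :: real
      unfolding islimpt_approachable
    proof (intro allI impI)
      fix e :: real assume "e > 0"
      then obtain r where "r \<in> \<rat>" "q < r" "r < q + e"
        using Rats_dense_in_real[of q "q + e"] by auto
      then show "\<exists>x'\<in>\<rat>. x' \<noteq> q \<and> dist x' q < e"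
        by (auto simp: dist_real_def intro!: bexI[of _ r])
    qed
    then have "\<exists>y. y \<noteq> q \<and> y \<in> \<rat> \<and> y \<in> T" if "q \<in> T" "open T" for q :: real and T
      using that by (meson islimpt_def)
    then show ?thesis
      by (auto simp: derived_set_of_subtopology in_derived_set_of)
  qed
  then have "(UNIV::real set) \<lesssim> (\<rat> :: real set)"
    using lepoll_perfect_set[of "top_of_set \<rat>" \<rat>] cm by (metis Rats_0 empty_iff)
  then show False
    using countable_lepoll countable_rat uncountable_UNIV_real by blast
qed

text \<open>
  The Dedekind cut of \<open>q\<close>, recorded only at the points of the sequence \<open>r\<close>.
\<close>
definition cut_code :: "(nat \<Rightarrow> real) \<Rightarrow> real \<Rightarrow> nat set" where
  "cut_code r q = {n. q < r n}"

text \<open>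
  An enumeration of a translate of \<open>\<rat>\<close> by an irrational number.
\<close>
lemma irrational_dense_sequence:
  obtains r :: "nat \<Rightarrow> real" where "\<And>n. r n \<notin> \<rat>" "\<And>a b. a < b \<Longrightarrow> \<exists>n. a < r n \<and> r n < b"
proof -
  obtain c :: real where c: "c \<notin> \<rat>"
    using countable_rat uncountable_UNIV_real by (metis UNIV_eq_I)
  define S where "S = (\<lambda>q. q + c) ` \<rat>"
  have S: "countable S" "S \<noteq> {}"
    using countable_rat by (auto simp: S_def)
  have "x \<notin> \<rat>" if "x \<in> S" for x
    using that c Rats_diff by (fastforce simp: S_def)
  then have "from_nat_into S n \<notin> \<rat>" for n
    using from_nat_into[OF S(2)] by blast
  moreover have "\<exists>n. a < from_nat_into S n \<and> from_nat_into S n < b" if ab: "a < b" for a b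
  proof -
    obtain q where q: "q \<in> \<rat>" "a - c < q" "q < b - c"
      using Rats_dense_in_real[of "a - c" "b - c"] ab by auto
    then have "q + c \<in> S"
      by (auto simp: S_def)
    then obtain n where "from_nat_into S n = q + c"
      using from_nat_into_surj[OF S(1)] by blast
    with q show ?thesis
      by (intro exI[of _ n]) auto
  qed
  ultimately show thesis
    by (rule that)
qed

text \<open>
  Since \<open>q\<close> differs from every \<open>r n\<close>, finitely many of the comparisons \<open>q < r n\<close> are unaffected by a
  small change of \<open>q\<close>.
\<close>
lemma agree_cut_if_close:
  assumes irr: "\<And>n. r n \<notin> \<rat>" and q: "q \<in> \<rat>"
  shows "\<exists>\<delta>>0. \<forall>x. \<bar>q - x\<bar> < \<delta> \<longrightarrow> agree n (cut_code r q) (cut_code r x)"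
proof (induction n)
  case 0
  show ?case by (auto simp: agree_def intro: exI[of _ 1])
next
  case (Suc n)
  then obtain \<delta> where \<delta>: "\<delta> > 0" "\<And>x. \<bar>q - x\<bar> < \<delta> \<Longrightarrow> agree n (cut_code r q) (cut_code r x)"
    by blast
  have "q \<noteq> r n"
    using irr q by metis
  with \<delta> show ?case
    by (intro exI[of _ "min \<delta> \<bar>q - r n\<bar>"]) (auto simp: agree_def less_Suc_eq cut_code_def)
qed

lemma close_if_agree_cut:
  assumes dense: "\<And>a b. a < b \<Longrightarrow> \<exists>n. a < r n \<and> r n < b" and "\<epsilon> > 0"
  shows "\<exists>n. \<forall>x. agree n (cut_code r q) (cut_code r x) \<longrightarrow> \<bar>q - x\<bar> < \<epsilon>"
proof -
  obtain m where m: "q - \<epsilon> < r m" "r m < q"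
    using dense[of "q - \<epsilon>" q] \<open>\<epsilon> > 0\<close> by auto
  obtain m' where m': "q < r m'" "r m' < q + \<epsilon>"
    using dense[of q "q + \<epsilon>"] \<open>\<epsilon> > 0\<close> by auto
  have "\<bar>q - x\<bar> < \<epsilon>" if "agree (Suc (max m m')) (cut_code r q) (cut_code r x)" for x
  proof -
    have "(q < r m) = (x < r m)" "(q < r m') = (x < r m')"
      using that by (auto simp: agree_def cut_code_def)
    with m m' show ?thesis by linarith
  qed
  then show ?thesis by blast
qed

text \<open>
  A set containing all large numbers is not a code: it would put the coded number below all but
  finitely many \<open>r m\<close>, while infinitely many \<open>r m\<close> lie below any given real number.
\<close>
lemma non_cuts_dense:
  assumes dense: "\<And>a b. a < b \<Longrightarrow> \<exists>n. a < r n \<and> r n < b"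
  shows "\<exists>i. i \<notin> cut_code r ` \<rat> \<and> agree n i y"
proof -
  define i where "i = y \<inter> {..<n} \<union> {n..}"
  have "i \<noteq> cut_code r x" for x
  proof
    assume i: "i = cut_code r x"
    \<comment> \<open>A value of r below all of these has an index m >= n and lies below x.\<close>
    let ?F = "insert x (r ` {..<n})"
    have "Min ?F - 1 < Min ?F"
      by linarith
    from dense[OF this] obtain m where m: "r m < Min ?F"
      by blast
    then have "r m < x" "r m \<notin> r ` {..<n}"
      by auto
    then have "m \<notin> cut_code r x" "m \<ge> n"
      by (auto simp: cut_code_def not_less[symmetric])
    with i show False
      by (auto simp: i_def)
  qed
  moreover have "agree n i y"
    by (auto simp: agree_def i_def)
  ultimately show ?thesis by blast
qed

theorem theorem3p1:
  shows "\<exists>(X :: real set) (d :: real \<Rightarrow> real \<Rightarrow> real).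
    Metric_space X d \<and> Metric_space.mbounded X d X \<and>
    completely_metrizable_space (Metric_space.mtopology X d) \<and>
    (\<exists>S. closedin (Metric_space.hausdorff_topology X d) S \<and>
         subtopology (Metric_space.hausdorff_topology X d) S
           homeomorphic_space top_of_set (\<rat> :: real set)) \<and>
    \<not> completely_metrizable_space (Metric_space.hausdorff_topology X d) \<and>
    BM_alpha_favorable (Metric_space.hausdorff_topology X d) \<and>
    Baire_space (Metric_space.hausdorff_topology X d)"
proof -
  obtain r :: "nat \<Rightarrow> real" where irr: "\<And>n. r n \<notin> \<rat>"
    and r_dense: "\<And>a b. a < b \<Longrightarrow> \<exists>n. a < r n \<and> r n < b"
    using irrational_dense_sequence by blast
  define I where "I = - (cut_code r ` \<rat>)"
  obtain e :: "nat set \<Rightarrow> real" where e: "inj e"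
    using nat_sets_eqpoll_reals by (metis bij_is_inj eqpoll_def)
  \<comment> \<open>The nat set coding (i, n) is the disjoint union of i and {n}; it is then sent to a real.\<close>
  define pt :: "nat set \<times> nat \<Rightarrow> real"
    where "pt = (\<lambda>(i, n). e (prod_encode ` ({0} \<times> i \<union> {1} \<times> {n})))"
  have "inj pt"
  proof (rule injI)
    fix u v assume uv: "pt u = pt v"
    obtain i m j n where ij: "u = (i, m)" "v = (j, n)"
      by (metis surj_pair)
    have "prod_encode ` ({0} \<times> i \<union> {1} \<times> {m}) = prod_encode ` ({0} \<times> j \<union> {1} \<times> {n})"
      using uv injD[OF e] unfolding pt_def ij prod.case by blast
    then have "{0} \<times> i \<union> {1} \<times> {m} = {0} \<times> j \<union> {1::nat} \<times> {n}"
      unfolding inj_image_eq_iff[OF inj_prod_encode] .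
    then show "u = v"
      unfolding ij by (auto simp: set_eq_iff)
  qed
  moreover have "\<exists>i\<in>I. agree n i y" for n y
    using non_cuts_dense[OF r_dense, of n y] unfolding I_def by blast
  ultimately interpret cantor_comb I pt
    by unfold_locales
  let ?\<phi> = "\<lambda>q. profile (cut_code r q)"
  have cut_notin: "cut_code r q \<notin> I" if "q \<in> \<rat>" for q
    using that by (simp add: I_def)
  interpret Q: Submetric UNIV dist "\<rat> :: real set"
    by unfold_locales auto
  have Q: "Q.sub.mtopology = top_of_set \<rat>"
    using Q.mtopology_submetric by simp
  have "Q.sub.mtopology homeomorphic_space subtopology H.mtopology (?\<phi> ` \<rat>)"
  proof (rule homeomorphic_onto_image_metric)
    show "Metric_space (\<rat> :: real set) dist" ..
    show "Metric_space X.CL X.hausdorff_dist" ..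
    show "?\<phi> ` \<rat> \<subseteq> X.CL"
      using profile_CL by blast
  next
    fix a \<epsilon> :: real assume a: "a \<in> \<rat>" and "\<epsilon> > 0"
    obtain n where n: "(1/2::real)^n < \<epsilon>"
      using real_arch_pow_inv[of \<epsilon> "1/2"] \<open>\<epsilon> > 0\<close> by auto
    obtain \<delta> where \<delta>: "\<delta> > 0" "\<And>x. \<bar>a - x\<bar> < \<delta> \<Longrightarrow> agree n (cut_code r a) (cut_code r x)"
      using agree_cut_if_close[of r, OF irr a] by blast
    show "\<exists>\<delta>>0. \<forall>x\<in>\<rat>. dist a x < \<delta> \<longrightarrow> X.hausdorff_dist (?\<phi> a) (?\<phi> x) < \<epsilon>"
    proof (intro exI[of _ \<delta>] conjI ballI impI \<open>\<delta> > 0\<close>)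
      fix x :: real assume x: "x \<in> \<rat>" "dist a x < \<delta>"
      have "X.hausdorff_dist (?\<phi> a) (?\<phi> x) \<le> (1/2)^n"
        using x a \<delta>(2) by (intro hausdorff_dist_profile_le cut_notin) (auto simp: dist_real_def)
      with n show "X.hausdorff_dist (?\<phi> a) (?\<phi> x) < \<epsilon>"
        by linarith
    qed
  next
    fix a \<epsilon> :: real assume a: "a \<in> \<rat>" and "\<epsilon> > 0"
    obtain n where n: "\<And>x. agree n (cut_code r a) (cut_code r x) \<Longrightarrow> \<bar>a - x\<bar> < \<epsilon>"
      using close_if_agree_cut[of r, OF r_dense \<open>\<epsilon> > 0\<close>] by blast
    show "\<exists>\<delta>>0. \<forall>x\<in>\<rat>. X.hausdorff_dist (?\<phi> a) (?\<phi> x) < \<delta> \<longrightarrow> dist a x < \<epsilon>"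
      using n agree_if_hausdorff_dist_profile_less[OF cut_notin[OF a] cut_notin]
      by (intro exI[of _ "(1/2)^n"]) (auto simp: dist_real_def)
  qed
  then have hom: "subtopology X.hausdorff_topology (?\<phi> ` \<rat>) homeomorphic_space top_of_set (\<rat> :: real set)"
    using Q homeomorphic_space_sym by (metis X.hausdorff_topology_def)
  have "?\<phi> ` \<rat> = profile ` (- I)"
    by (auto simp: I_def)
  then have closed: "closedin X.hausdorff_topology (?\<phi> ` \<rat>)"
    using closedin_profile_image by simp
  have "\<not> completely_metrizable_space X.hausdorff_topology"
    using completely_metrizable_space_closedin[OF _ closed]
      homeomorphic_completely_metrizable_space[OF hom] rationals_not_completely_metrizable by blast
  moreover have "completely_metrizable_space X.mtopology"
    by (simp add: mtopology_comb completely_metrizable_space_discrete_topology)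
  moreover have "BM_alpha_favorable X.hausdorff_topology" "Baire_space X.hausdorff_topology"
    using BM_alpha_favorable_if_dense_isolated Baire_space_if_dense_isolated dense_isolated by blast+
  ultimately show ?thesis
    using X.Metric_space_axioms mbounded_comb closed hom by blast
qed

end
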